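(* Let $(X,\{\leq\})$ be a relator space where $X$ is a set, $\leq$ is a partial order on $X$, and $\check{\delta}_{\leq}$ is the proximity induced by $\leq$. Then the proximity graph $\check{\mathcal{P}}_\leq(X)$ is equivalent to the Hasse diagram $\mathcal{H}s_\leq(X)$.
   Context: A relator space $(X,\mathcal{R})$ is a set $X$ together with a family $\mathcal{R}$ of relations on $X$. A partial order is a reflexive, antisymmetric, transitive binary relation. Induced proximity: for $a,b\in X$, $\check{\delta}_\leq(a,b)=0$ if and only if $a\leq b$ and there is no $x\in X\setminus\{a,b\}$ with $a\leq x\leq b$; and $\check{\delta}_\leq(a,b)=1$ if and only if $a\leq b$ and there is an $x\in X\setminus\{a,b\}$ with $a\leq x\leq b$. (If $a\leq b$ fails, no induced proximity relation is assigned to $(a,b)$.) Graphs: $\check{\mathcal{O}}_\leq(X)$ is the directed graph with vertex set $X$ having an edge $a\to b$ if $a\leq b$. $\check{\mathcal{P}}_\leq(X)$ is the directed graph with vertex set $X$ having an edge $a\to b$ if $\check{\delta}_\leq(a,b)=0$. A transitive reduction of a directed graph $D_1$ is a directed graph $D_2$ with the same vertex set but a reduced edge set, such that if there is a path between vertices $v_1$ and $v_2$ in $D_1$ then there is also such a path in $D_2$. The Hasse diagram $\mathcal{H}s_\leq(X)$ is the transitive reduction of $\check{\mathcal{O}}_\leq(X)$. "Equivalent" is used in the sense that the two graphs are the same.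
   Formalization: The Hasse diagram is assumed to exist, as an inclusion-minimal subgraph of the order graph keeping all its paths (of at least one edge); for some infinite orders, such as the rationals, there is none. *)

theory Defs
  imports "Graph_Theory.Pair_Digraph" "Graph_Theory.Digraph_Component"
begin

definition relator_space :: "'a set \<Rightarrow> 'a rel set \<Rightarrow> bool" where
  "relator_space X Rels \<longleftrightarrow> (\<forall>R\<in>Rels. R \<subseteq> X \<times> X)"

(* None: the order assigns no proximity value to the pair (a, b). *)
definition induced_proximity :: "'a set \<Rightarrow> 'a rel \<Rightarrow> 'a \<Rightarrow> 'a \<Rightarrow> nat option" where
  "induced_proximity X R a b =
     (if (a, b) \<in> R
      then Some (if \<exists>x \<in> X - {a, b}. (a, x) \<in> R \<and> (x, b) \<in> R then 1 else 0)
      else None)"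

definition order_graph :: "'a set \<Rightarrow> 'a rel \<Rightarrow> 'a pair_pre_digraph" where
  "order_graph X R = \<lparr> pverts = X, parcs = {(a, b) \<in> X \<times> X. (a, b) \<in> R} \<rparr>"

(* Every vertex carries a loop: by antisymmetry, no x other than a has a \<le> x \<le> a. *)
definition proximity_graph :: "'a set \<Rightarrow> 'a rel \<Rightarrow> 'a pair_pre_digraph" where
  "proximity_graph X R =
     \<lparr> pverts = X, parcs = {(a, b) \<in> X \<times> X. induced_proximity X R a b = Some 0} \<rparr>"

(* A path from u to v is a walk with at least one arc. With empty paths allowed, the
   transitive reduction of a reflexive relation loses its loops. *)
definition preserves_paths :: "'a pair_pre_digraph \<Rightarrow> 'a pair_pre_digraph \<Rightarrow> bool" where
  "preserves_paths D1 D2 \<longleftrightarrow>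
     (\<forall>v1 v2. v1 \<rightarrow>\<^sup>+\<^bsub>with_proj D1\<^esub> v2 \<longrightarrow> v1 \<rightarrow>\<^sup>+\<^bsub>with_proj D2\<^esub> v2)"

(* The arc set of D2 is reduced: it is contained in that of D1, and no arcs can be
   removed from it without losing a path of D1. *)
definition transitive_reduction :: "'a pair_pre_digraph \<Rightarrow> 'a pair_pre_digraph \<Rightarrow> bool" where
  "transitive_reduction D1 D2 \<longleftrightarrow>
     spanning (with_proj D2) (with_proj D1) \<and> preserves_paths D1 D2 \<and>
     (\<forall>D. spanning (with_proj D) (with_proj D2) \<and> preserves_paths D1 D \<longrightarrow> D = D2)"

(* A predicate and not a function: a transitive reduction need not exist when X is
   infinite, for example for the usual order on the rationals. *)
definition hasse_diagram :: "'a set \<Rightarrow> 'a rel \<Rightarrow> 'a pair_pre_digraph \<Rightarrow> bool" where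
  "hasse_diagram X R H \<longleftrightarrow> transitive_reduction (order_graph X R) H"

lemma spanning_order_graph_iff:
  "spanning (with_proj H) (with_proj (order_graph X R)) \<longleftrightarrow>
     pverts H = X \<and> parcs H \<subseteq> parcs (order_graph X R)"
  by (auto simp: spanning_def subgraph_def compatible_def wf_digraph_def order_graph_def)

lemma hasse_diagram_exists:
  assumes "finite X"
  shows "\<exists>H. hasse_diagram X R H"
proof -
  let ?O = "order_graph X R"
  let ?A = "{A. A \<subseteq> parcs ?O \<and> preserves_paths ?O \<lparr> pverts = X, parcs = A \<rparr>}"
  have "finite (parcs ?O)"
    using assms by (auto simp: order_graph_def intro: finite_subset[of _ "X \<times> X"])
  then have "finite ?A" by simp
  moreover have "parcs ?O \<in> ?A"
    by (simp add: preserves_paths_def)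
  then have "?A \<noteq> {}" by blast
  ultimately obtain M where M: "M \<in> ?A" and "\<forall>A\<in>?A. A \<subseteq> M \<longrightarrow> M = A"
    using finite_has_minimal[of ?A] by blast
  then have min: "A = M" if "A \<in> ?A" "A \<subseteq> M" for A
    using that by blast
  let ?M = "\<lparr> pverts = X, parcs = M \<rparr> :: 'a pair_pre_digraph"
  have sp: "spanning (with_proj ?M) (with_proj ?O)"
    using M by (simp add: spanning_order_graph_iff)
  have "D = ?M" if D: "spanning (with_proj D) (with_proj ?M)" "preserves_paths ?O D" for D
  proof -
    have D': "pverts D = X" "parcs D \<subseteq> M"
      using D(1) by (auto simp: spanning_def subgraph_def)
    then have eq: "D = \<lparr> pverts = X, parcs = parcs D \<rparr>" by simp
    then have "parcs D \<in> ?A" using D(2) D'(2) M by auto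
    then have "parcs D = M" using D'(2) min by blast
    then show ?thesis using eq by simp
  qed
  then show ?thesis
    using sp M unfolding hasse_diagram_def transitive_reduction_def by blast
qed

end

theory Submission
  imports Defs
begin

text \<open>
  Both inclusions between the arc sets rest on one observation: a walk of the Hasse diagram
  is an ascending chain of the order, so it stays inside the order interval spanned by its
  two ends. An arc \<open>(a, b)\<close> of the proximity graph has no element other than \<open>a\<close> and \<open>b\<close>
  in its interval, so a walk from \<open>a\<close> to \<open>b\<close> can only visit these two vertices and must
  use the arc \<open>(a, b)\<close> itself. This covers the loops, where \<open>a = b\<close>, as well as the
  covering pairs.

  Conversely, if an arc \<open>(a, b)\<close> of the Hasse diagram has an element \<open>x\<close> strictly
  between its ends, then walks from \<open>a\<close> to \<open>x\<close> and from \<open>x\<close> to \<open>b\<close> exist, since both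
  pairs are in the order. The interval of the former misses \<open>b\<close>, that of the latter
  misses \<open>a\<close>, so neither walk uses the arc \<open>(a, b)\<close>. Together they bypass that arc, which
  could thus be removed, against the minimality of the transitive reduction.
\<close>

lemma preserves_paths_iff:
  "preserves_paths D1 D2 \<longleftrightarrow> (parcs D1)\<^sup>+ \<subseteq> (parcs D2)\<^sup>+"
  by (auto simp: preserves_paths_def arcs_ends_conv)

lemma proximity_graph_arc_iff:
  "(a, b) \<in> parcs (proximity_graph X R) \<longleftrightarrow>
     a \<in> X \<and> b \<in> X \<and> (a, b) \<in> R \<and> (\<forall>x\<in>X. (a, x) \<in> R \<longrightarrow> (x, b) \<in> R \<longrightarrow> x = a \<or> x = b)"
  by (auto simp: proximity_graph_def induced_proximity_def)

text \<open>
  The last vertex before \<open>b\<close> on the walk lies between \<open>a\<close> and \<open>b\<close>. If it is \<open>a\<close>, the last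
  step is the wanted one; if it is \<open>b\<close>, the walk can be shortened.
\<close>

lemma step_in_chain_if_nothing_between:
  assumes "(a, b) \<in> E\<^sup>+" and "E \<subseteq> R" and "trans R"
    and "\<And>x. (a, x) \<in> R \<Longrightarrow> (x, b) \<in> R \<Longrightarrow> x = a \<or> x = b"
  shows "(a, b) \<in> E"
  using assms(1,4)
proof (induction rule: trancl_induct)
  case (step y z)
  have "(a, y) \<in> R"
    using step.hyps(1) trancl_mono[OF _ assms(2)] assms(3) by (metis trancl_id)
  moreover have "(y, z) \<in> R"
    using step.hyps(2) assms(2) by blast
  ultimately have "y = a \<or> y = z"
    by (rule step.prems)
  then show ?case
    using step by blast
qed

text \<open>
  A chain from \<open>u\<close> to \<open>v\<close> that contains the step from \<open>a\<close> to \<open>b\<close> has \<open>a\<close> equal to or above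
  \<open>u\<close> and \<open>b\<close> equal to or below \<open>v\<close>, so no such chain exists once one of the two fails.
\<close>

lemma chain_avoids_step_outside_interval:
  assumes "(u, v) \<in> E\<^sup>+" and "E \<subseteq> R" and "trans R"
    and "(u, a) \<in> R\<^sup>= \<Longrightarrow> (b, v) \<in> R\<^sup>= \<Longrightarrow> False"
  shows "(u, v) \<in> (E - {(a, b)})\<^sup>+"
  using assms(1,4)
proof (induction rule: trancl_induct)
  case (base y)
  then show ?case by blast
next
  case (step y z)
  have uy: "(u, y) \<in> R"
    using step.hyps(1) trancl_mono[OF _ assms(2)] assms(3) by (metis trancl_id)
  have yz: "(y, z) \<in> R"
    using step.hyps(2) assms(2) by blast
  have "(u, y) \<in> (E - {(a, b)})\<^sup>+"
    using step.IH step.prems yz assms(3) by (blast dest: transD)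
  moreover have "(y, z) \<in> E - {(a, b)}"
    using step.hyps(2) step.prems uy by blast
  ultimately show ?case
    by (rule trancl_into_trancl)
qed

theorem theorem2:
  fixes X :: "'a set" and R :: "'a rel" and H :: "'a pair_pre_digraph"
  assumes "relator_space X {R}"
    and "partial_order_on X R"
    and "hasse_diagram X R H"
  shows "proximity_graph X R = H"
proof -
  have RX: "R \<subseteq> X \<times> X"
    using assms(1) by (simp add: relator_space_def)
  have trans: "trans R" and antisym: "antisym R"
    using assms(2) by (auto simp: partial_order_on_def preorder_on_def)
  have order_arcs: "parcs (order_graph X R) = R"
    using RX by (auto simp: order_graph_def)
  have HX: "pverts H = X" and HR: "parcs H \<subseteq> R"
    using assms(3) order_arcs
    by (auto simp: hasse_diagram_def transitive_reduction_def spanning_order_graph_iff)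
  have paths: "R \<subseteq> (parcs H)\<^sup>+"
    using assms(3) trans
    by (simp add: hasse_diagram_def transitive_reduction_def preserves_paths_iff order_arcs)
  have minimal: "D = H"
    if "spanning (with_proj D) (with_proj H)" "preserves_paths (order_graph X R) D" for D
    using assms(3) that by (auto simp: hasse_diagram_def transitive_reduction_def)
  have "parcs (proximity_graph X R) \<subseteq> parcs H"
  proof (rule subrelI)
    fix a b assume "(a, b) \<in> parcs (proximity_graph X R)"
    then have "(a, b) \<in> R" and between: "\<And>x. (a, x) \<in> R \<Longrightarrow> (x, b) \<in> R \<Longrightarrow> x = a \<or> x = b"
      using RX by (auto simp: proximity_graph_arc_iff)
    with paths have "(a, b) \<in> (parcs H)\<^sup>+"
      by blast
    then show "(a, b) \<in> parcs H"
      using HR trans between by (rule step_in_chain_if_nothing_between)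
  qed
  moreover have "parcs H \<subseteq> parcs (proximity_graph X R)"
  proof (rule subrelI, rule ccontr)
    fix a b assume ab: "(a, b) \<in> parcs H" and "(a, b) \<notin> parcs (proximity_graph X R)"
    with HR RX obtain x where x: "(a, x) \<in> R" "(x, b) \<in> R" "x \<noteq> a" "x \<noteq> b"
      by (auto simp: proximity_graph_arc_iff)
    let ?E = "parcs H - {(a, b)}"
    let ?D = "\<lparr> pverts = X, parcs = ?E \<rparr>"
    \<comment> \<open>A use of the arc would give \<open>b \<le> x\<close> here and \<open>x \<le> a\<close> in the second half.\<close>
    have "(a, x) \<in> ?E\<^sup>+"
      using x antisym paths
      by (intro chain_avoids_step_outside_interval[OF _ HR trans]) (auto dest: antisymD)
    moreover have "(x, b) \<in> ?E\<^sup>+"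
      using x antisym paths
      by (intro chain_avoids_step_outside_interval[OF _ HR trans]) (auto dest: antisymD)
    ultimately have "(a, b) \<in> ?E\<^sup>+"
      by (rule trancl_trans)
    then have "parcs H \<subseteq> ?E\<^sup>+"
      by auto
    then have "(parcs H)\<^sup>+ \<subseteq> ?E\<^sup>+"
      by (metis trancl_id trancl_mono_subset trans_trancl)
    then have "preserves_paths (order_graph X R) ?D"
      using paths trans by (auto simp: preserves_paths_iff order_arcs)
    moreover have "spanning (with_proj ?D) (with_proj H)"
      using HX HR RX by (auto simp: spanning_def subgraph_def compatible_def wf_digraph_def)
    ultimately have "?D = H"
      by (intro minimal)
    then have "parcs H = ?E"
      by (metis pair_pre_digraph.select_convs(2))
    with ab show False
      by blast
  qed
  ultimately show ?thesis
    using HX by (simp add: proximity_graph_def)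
qed

end
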